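(* Let $X$ be a $\sigma$-compact topological space, $\lambda$ a Borel probability measure on $X$, and $f:X\to X$ a Borel measurable map with $f_*\lambda\ll\lambda$ which is ergodic conservative with respect to $\lambda$. Then $f$ has a nonzero $\sigma$-finite invariant Borel measure absolutely continuous with respect to $\lambda$ if and only if there exists a $\lambda$-partition $\mathcal G$ of $X$ with $\mathcal M_s(\mathcal G,f)\neq\emptyset$.
   Context: $f_*\mu(A)=\mu(f^{-1}(A))$; $\mu$ is invariant if $f_*\mu=\mu$. $\mathcal B_\sigma(X)$ is the set of $\sigma$-finite Borel measures on $X$. $f$ is ergodic conservative with respect to $\lambda$ if for every measurable set $A$ with $\lambda(A)>0$, for $\lambda$-almost every $x$ there is $n\ge1$ with $f^n(x)\in A$. A $\lambda$-partition $\mathcal G$ of $X$ is a countable collection of pairwise disjoint Borel subsets of $X$ such that each $I\in\mathcal G$ is $\sigma$-compact, $0<\lambda(I)<\infty$ for each $I\in\mathcal G$, and $\lambda(X\setminus\bigcup_{I\in\mathcal G}I)=0$. For $\mu\in\mathcal B_\sigma(X)$, $I\in\mathcal G$, $K>0$ define: m1($I,K$): $\mu(I)\in[\frac1K,K]$. m2($I,K$): for all $n\ge0$, $0<\mu(f^{-n}(I))<\infty$, and for every measurable $A\subset I$, $\frac1K\frac{\lambda(A)}{\lambda(I)}\le\frac{\mu(f^{-n}(A))}{\mu(f^{-n}(I))}\le K\frac{\lambda(A)}{\lambda(I)}$. m3($I$): $\sup_{n\ge0}\mu(f^{-n}(I))<\infty$. $\mathcal M(\mathcal G,f)$ is the set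 of $\mu\in\mathcal B_\sigma(X)$, $\mu\ll\lambda$, such that for every $I\in\mathcal G$ there is $K>0$ for which m1($I,K$) and m2($I,K$) hold. $\mathcal M_s(\mathcal G,f)$ is the set of $\mu\in\mathcal M(\mathcal G,f)$ such that m3($I$) holds for all $I\in\mathcal G$.
   Formalization: The Borel probability measure λ is additionally assumed inner regular with respect to compact Borel sets (automatic on σ-compact metric spaces); without this, an invariant measure need not yield a λ-partition by σ-compact sets. *)

theory Defs
  imports "HOL-Probability.Probability"
begin

definition sigma_compact :: "'a::topological_space set \<Rightarrow> bool" where
  "sigma_compact S \<longleftrightarrow> (\<exists>\<K>. countable \<K> \<and> (\<forall>K\<in>\<K>. compact K) \<and> S = \<Union>\<K>)"

text \<open>The Radon property of a finite Borel measure. A partition into \<open>\<sigma>\<close>-compact sets adapted to a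
  given density need not exist for a Borel measure without it. On a \<open>\<sigma>\<close>-compact metric space it is
  automatic, see \<open>inner_regular_compact_metric\<close> at the end. In a non-Hausdorff space a
  compact set need not be Borel, hence the explicit measurability of \<open>K\<close>.\<close>
definition inner_regular_compact :: "'a::topological_space measure \<Rightarrow> bool" where
  "inner_regular_compact M \<longleftrightarrow>
     (\<forall>B\<in>sets borel. emeasure M B =
        (SUP K\<in>{K. K \<in> sets borel \<and> compact K \<and> K \<subseteq> B}. emeasure M K))"

definition sigma_finite_borel :: "'a::topological_space measure set" where
  "sigma_finite_borel = {M. sets M = sets borel \<and> sigma_finite_measure M}"

definition ergodic_conservative :: "'a measure \<Rightarrow> ('a \<Rightarrow> 'a) \<Rightarrow> bool" where
  "ergodic_conservative L f \<longleftrightarrow>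
     (\<forall>A\<in>sets L. emeasure L A > 0 \<longrightarrow> (AE x in L. \<exists>n\<ge>1. (f ^^ n) x \<in> A))"

definition measure_partition :: "'a::topological_space measure \<Rightarrow> 'a set set \<Rightarrow> bool" where
  "measure_partition L \<G> \<longleftrightarrow>
     countable \<G> \<and> \<G> \<subseteq> sets borel \<and> disjoint \<G> \<and>
     (\<forall>I\<in>\<G>. sigma_compact I \<and> 0 < emeasure L I \<and> emeasure L I < \<infinity>) \<and>
     emeasure L (UNIV - \<Union>\<G>) = 0"

definition m1 :: "'a measure \<Rightarrow> 'a set \<Rightarrow> real \<Rightarrow> bool" where
  "m1 M I K \<longleftrightarrow> ennreal (1 / K) \<le> emeasure M I \<and> emeasure M I \<le> ennreal K"

text \<open>The quotients are taken in the reals. For \<open>M\<close> this is harmless because of the first conjunct,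
  and \<open>L\<close> is only ever a probability measure with \<open>I\<close> of positive measure.\<close>
definition m2 ::
  "'a::topological_space measure \<Rightarrow> ('a \<Rightarrow> 'a) \<Rightarrow> 'a measure \<Rightarrow> 'a set \<Rightarrow> real \<Rightarrow> bool" where
  "m2 L f M I K \<longleftrightarrow>
     (\<forall>n. 0 < emeasure M ((f ^^ n) -` I) \<and> emeasure M ((f ^^ n) -` I) < \<infinity> \<and>
        (\<forall>A\<in>sets borel. A \<subseteq> I \<longrightarrow>
           1 / K * (measure L A / measure L I)
             \<le> measure M ((f ^^ n) -` A) / measure M ((f ^^ n) -` I) \<and>
           measure M ((f ^^ n) -` A) / measure M ((f ^^ n) -` I)
             \<le> K * (measure L A / measure L I)))"

definition m3 :: "('a \<Rightarrow> 'a) \<Rightarrow> 'a measure \<Rightarrow> 'a set \<Rightarrow> bool" where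
  "m3 f M I \<longleftrightarrow> (SUP n. emeasure M ((f ^^ n) -` I)) < \<infinity>"

definition MM ::
  "'a::topological_space measure \<Rightarrow> 'a set set \<Rightarrow> ('a \<Rightarrow> 'a) \<Rightarrow> 'a measure set" where
  "MM L \<G> f = {M \<in> sigma_finite_borel. absolutely_continuous L M \<and>
     (\<forall>I\<in>\<G>. \<exists>K>0. m1 M I K \<and> m2 L f M I K)}"

definition MM_s ::
  "'a::topological_space measure \<Rightarrow> 'a set set \<Rightarrow> ('a \<Rightarrow> 'a) \<Rightarrow> 'a measure set" where
  "MM_s L \<G> f = {M \<in> MM L \<G> f. \<forall>I\<in>\<G>. m3 f M I}"

lemma closed_open_approx:
  fixes M :: "'a::metric_space measure"
  assumes M: "sets M = sets borel" "finite_measure M" and "B \<in> sets borel"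
  shows "\<forall>e>0. \<exists>C U. closed C \<and> open U \<and> C \<subseteq> B \<and> B \<subseteq> U \<and> measure M (U - C) < e"
proof -
  interpret finite_measure M by fact
  have bm: "C \<in> sets M" if "closed C \<or> open C" for C
    unfolding M(1) using that by (auto intro: borel_closed borel_open)
  have "B \<in> sigma_sets UNIV (Collect closed)"
    using assms(3) unfolding borel_eq_closed by (subst (asm) sets_measure_of) auto
  then show ?thesis
  proof induction
    case (Basic C)
    then have C: "closed C" by auto
    show ?case
    proof (cases "C = {}")
      case True then show ?thesis by (intro allI impI exI[of _ "{}"]) simp
    next
      case False
      define U where "U n = {x. infdist x C < 1 / real (Suc n)}" for n
      have oU: "open (U n)" for n unfolding U_def
        by (intro open_Collect_less continuous_intros)
      have CU: "C \<subseteq> U n" for n by (auto simp: U_def)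
      have int: "(\<Inter>n. U n - C) = {}"
      proof (rule equals0I)
        fix x assume "x \<in> (\<Inter>n. U n - C)"
        then have a: "x \<notin> C" "\<And>n. infdist x C < 1 / real (Suc n)" by (auto simp: U_def)
        then have "infdist x C \<noteq> 0"
          using in_closed_iff_infdist_zero[OF C False] by blast
        then have "infdist x C > 0" using infdist_nonneg[of x C] by linarith
        then obtain n where "1 / real (Suc n) < infdist x C" by (rule nat_approx_posE)
        with a(2)[of n] show False by linarith
      qed
      have "(\<lambda>n. measure M (U n - C)) \<longlonglongrightarrow> measure M (\<Inter>n. U n - C)"
      proof (rule finite_Lim_measure_decseq)
        show "range (\<lambda>n. U n - C) \<subseteq> sets M" using oU C bm by auto
        have "1 / real (Suc n) \<le> 1 / real (Suc m)" if "m \<le> n" for m n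
          using that by (intro divide_left_mono) auto
        then have "U n \<subseteq> U m" if "m \<le> n" for m n
          using that unfolding U_def by (blast intro: less_le_trans)
        then show "decseq (\<lambda>n. U n - C)" unfolding decseq_def by blast
      qed
      then have l: "(\<lambda>n. measure M (U n - C)) \<longlonglongrightarrow> 0" unfolding int by simp
      show ?thesis
      proof (intro allI impI)
        fix e :: real assume "e > 0"
        then have "eventually (\<lambda>n. measure M (U n - C) < e) sequentially"
          using l by (intro order_tendstoD(2))
        then obtain n where "measure M (U n - C) < e"
          using eventually_happens'[OF sequentially_bot] by blast
        then show "\<exists>D W. closed D \<and> open W \<and> D \<subseteq> C \<and> C \<subseteq> W \<and> measure M (W - D) < e"
          using C oU CU by blast
      qed
    qed
  next
    case Empty then show ?case by (intro allI impI exI[of _ "{}"]) simp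
  next
    case (Compl A)
    show ?case
    proof (intro allI impI)
      fix e :: real assume "e > 0"
      then have "\<exists>C U. closed C \<and> open U \<and> C \<subseteq> A \<and> A \<subseteq> U \<and> measure M (U - C) < e"
        using Compl.IH by simp
      then obtain C U where *: "closed C" "open U" "C \<subseteq> A" "A \<subseteq> U" "measure M (U - C) < e"
        by (elim exE conjE)
      have "(- C) - (- U) = U - C" by blast
      with * show "\<exists>C U. closed C \<and> open U \<and> C \<subseteq> UNIV - A \<and> UNIV - A \<subseteq> U \<and> measure M (U - C) < e"
        by (intro exI[of _ "- U"] exI[of _ "- C"] conjI open_Compl closed_Compl) (blast | simp)+
    qed
  next
    case (Union A)
    show ?case
    proof (intro allI impI)
      fix e :: real assume e: "e > 0"
      define \<delta> where "\<delta> i = e / 2 * (1/2)^Suc i" for i :: nat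
      have \<delta>: "\<delta> i > 0" for i using e by (simp add: \<delta>_def)
      have "\<exists>C U. closed C \<and> open U \<and> C \<subseteq> A i \<and> A i \<subseteq> U \<and> measure M (U - C) < \<delta> i" for i
        using Union.IH[of i] \<delta>[of i] by simp
      then have "\<forall>i. \<exists>p. closed (fst p) \<and> open (snd p) \<and> fst p \<subseteq> A i \<and> A i \<subseteq> snd p \<and>
          measure M (snd p - fst p) < \<delta> i" by simp
      then obtain p where p: "\<forall>i. closed (fst (p i)) \<and> open (snd (p i)) \<and> fst (p i) \<subseteq> A i \<and>
          A i \<subseteq> snd (p i) \<and> measure M (snd (p i) - fst (p i)) < \<delta> i"
        by (rule choice[THEN exE])
      define C where "C i = fst (p i)" for i
      define U where "U i = snd (p i)" for i
      have *: "closed (C i)" "open (U i)" "C i \<subseteq> A i" "A i \<subseteq> U i" "measure M (U i - C i) < \<delta> i" for i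
        using p by (simp_all add: C_def U_def)
      define D where "D n = (\<Union>i\<le>n. C i)" for n :: nat
      have cD: "closed (D n)" for n unfolding D_def using *(1) by (intro closed_UN) auto
      define V where "V = (\<Union>i. U i)"
      have oV: "open V" unfolding V_def using *(2) by (intro open_UN) auto
      have s: "\<delta> sums (e/2)"
        using sums_mult[OF power_half_series, of "e/2"] unfolding \<delta>_def mult_1_right .
      have sm: "summable (\<lambda>i. measure M (U i - C i))"
        by (rule summable_comparison_test'[OF sums_summable[OF s], of 0])
          (simp add: less_imp_le[OF *(5)])
      have "range (\<lambda>i. U i - C i) \<subseteq> sets M"
        using *(1,2) by (intro image_subsetI sets.Diff bm) simp_all
      then have le: "measure M (\<Union>i. U i - C i) \<le> (\<Sum>i. measure M (U i - C i))"
        using sm by (rule finite_measure_subadditive_countably)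
      have "(\<Sum>i. measure M (U i - C i)) \<le> (\<Sum>i. \<delta> i)"
        by (rule suminf_le[OF _ sm sums_summable[OF s]]) (rule less_imp_le[OF *(5)])
      then have "(\<Sum>i. measure M (U i - C i)) \<le> e/2" using s by (simp add: sums_iff)
      with le have l1: "measure M (\<Union>i. U i - C i) \<le> e/2" by linarith
      have l: "(\<lambda>n. measure M (V - D n)) \<longlonglongrightarrow> measure M (\<Inter>n. V - D n)"
      proof (rule finite_Lim_measure_decseq)
        show "range (\<lambda>n. V - D n) \<subseteq> sets M" using oV cD by (intro image_subsetI sets.Diff bm) simp_all
        have "D m \<subseteq> D n" if "m \<le> n" for m n
          unfolding D_def using that by (intro UN_mono) auto
        then show "decseq (\<lambda>n. V - D n)" unfolding decseq_def by blast
      qed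
      have "(\<Inter>n. V - D n) \<subseteq> (\<Union>i. U i - C i)"
        unfolding V_def D_def by blast
      moreover have "(\<Union>i. U i - C i) \<in> sets M"
        using \<open>range (\<lambda>i. U i - C i) \<subseteq> sets M\<close> by (rule sets.countable_UN)
      ultimately have "measure M (\<Inter>n. V - D n) \<le> measure M (\<Union>i. U i - C i)"
        by (rule finite_measure_mono)
      with l1 e have "measure M (\<Inter>n. V - D n) < e" by linarith
      then have "eventually (\<lambda>n. measure M (V - D n) < e) sequentially"
        using l by (intro order_tendstoD(2))
      then obtain n where n: "measure M (V - D n) < e"
        using eventually_happens'[OF sequentially_bot] by blast
      have "D n \<subseteq> (\<Union>i. A i)" unfolding D_def using *(3) by (intro UN_mono) simp_all
      moreover have "(\<Union>i. A i) \<subseteq> V" unfolding V_def using *(4) by (intro UN_mono) simp_all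
      ultimately show "\<exists>C U. closed C \<and> open U \<and> C \<subseteq> \<Union> (range A) \<and> \<Union> (range A) \<subseteq> U \<and> measure M (U - C) < e"
        using n cD oV by (intro exI[of _ "D n"] exI[of _ V] conjI)
    qed
  qed
qed

lemma inner_regular_compact_metric:
  fixes M :: "'a::metric_space measure"
  assumes X: "sigma_compact (UNIV :: 'a set)" and M: "sets M = sets borel" "finite_measure M"
  shows "inner_regular_compact M"
  unfolding inner_regular_compact_def
proof
  fix B :: "'a set" assume B: "B \<in> sets borel"
  interpret finite_measure M by fact
  let ?\<C> = "{K. K \<in> sets borel \<and> compact K \<and> K \<subseteq> B}"
  obtain \<K> :: "'a set set" where K: "countable \<K>" "\<forall>K\<in>\<K>. compact K" "UNIV = \<Union>\<K>"
    using X by (auto simp: sigma_compact_def)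
  then have ne: "\<K> \<noteq> {}" by auto
  define k where "k = from_nat_into \<K>"
  have k: "compact (k n)" "(\<Union>n. k n) = UNIV" for n
    using K ne by (auto simp: k_def from_nat_into range_from_nat_into)
  show "emeasure M B = (SUP K\<in>?\<C>. emeasure M K)"
  proof (rule ennreal_approx_SUP)
    fix K assume "K \<in> ?\<C>" then show "emeasure M K \<le> emeasure M B"
      using B M by (auto intro!: emeasure_mono)
  next
    fix e :: real assume e: "e > 0"
    then obtain C U where C: "closed C" "open U" "C \<subseteq> B" "B \<subseteq> U" "measure M (U - C) < e / 2"
      using closed_open_approx[OF M B] by (meson half_gt_zero)
    have sC: "C \<in> sets M" "U \<in> sets M" "B \<in> sets M" using C B M by auto
    define D where "D n = C \<inter> (\<Union>i\<le>n. k i)" for n :: nat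
    have D: "compact (D n)" for n unfolding D_def using C k
      by (intro closed_Int_compact compact_UN) auto
    then have sD: "D n \<in> sets M" for n using M by (simp add: borel_compact)
    have "(\<lambda>n. measure M (D n)) \<longlonglongrightarrow> measure M (\<Union>n. D n)"
      using sD by (intro finite_Lim_measure_incseq) (auto simp: incseq_def D_def intro: order_trans)
    moreover have "(\<Union>n. D n) = C" unfolding D_def using k(2) by auto
    ultimately have "(\<lambda>n. measure M (D n)) \<longlonglongrightarrow> measure M C" by simp
    then have "eventually (\<lambda>n. measure M C - e / 2 < measure M (D n)) sequentially"
      by (rule order_tendstoD(1)) (use e in simp)
    then obtain n where n: "measure M C - e / 2 < measure M (D n)"
      by (auto simp: eventually_sequentially)
    have "measure M B \<le> measure M (C \<union> (U - C))"
      using sC C by (intro finite_measure_mono) auto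
    also have "\<dots> \<le> measure M C + measure M (U - C)"
      using sC by (intro measure_Un_le) auto
    finally have "measure M B \<le> measure M (D n) + e" using n C(5) by simp
    then have "emeasure M B \<le> emeasure M (D n) + ennreal e"
      using e unfolding emeasure_eq_measure
      by (metis ennreal_leI ennreal_plus less_imp_le measure_nonneg)
    moreover have "D n \<in> ?\<C>" using D sD M C by (auto simp: D_def)
    ultimately show "\<exists>K\<in>?\<C>. emeasure M B \<le> emeasure M K + ennreal e" by blast
  qed
qed

end

theory Submission
  imports Defs
begin

text \<open>Conservativity and Borel--Cantelli show that a nonzero measure \<open>R \<ll> L\<close> has
  \<open>\<Sum>\<^sub>n R (f\<^sup>-\<^sup>n A) = \<infinity>\<close> whenever \<open>L A > 0\<close>; this is used three times. First, an invariant \<open>M\<close>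
  therefore has a density with values in \<open>(0, \<infinity>)\<close>, and \<open>\<sigma>\<close>-compact parts of its level sets form a
  partition for which \<open>M\<close> itself lies in \<open>MM_s\<close>.

  Conversely, given \<open>M\<close> in \<open>MM_s\<close>, let \<open>S\<^sub>n A = \<Sum>k<n. M (f\<^sup>-\<^sup>k A)\<close>. Conservativity and the bounds of
  \<open>m2\<close> and \<open>m3\<close> dominate \<open>S\<^sub>n / S\<^sub>n I\<^sub>0\<close> on each piece of the partition by a multiple of \<open>L\<close>, uniformly
  in \<open>n\<close>. Tychonoff's theorem gives a setwise limit along a filter, and domination makes it
  \<open>\<sigma>\<close>-additive on each piece. Secondly, \<open>S\<^sub>n I\<^sub>0\<close> tends to \<open>\<infinity>\<close>, so the limit \<open>N\<close> satisfies
  \<open>N (f\<^sup>-\<^sup>1 A) \<le> N A\<close>. Thirdly, the defect \<open>R A = N A - N (f\<^sup>-\<^sup>1 A)\<close> telescopes along orbits to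
  \<open>\<Sum>\<^sub>n R (f\<^sup>-\<^sup>n A) \<le> N A\<close>, which forces \<open>R = 0\<close>.\<close>

section \<open>Limits and differences of set functions\<close>

text \<open>By Tychonoff the function space over a compact order is compact, so the functions
  \<open>q n\<close> have a cluster point. The indices will be arbitrary sets, where a pointwise
  convergent subsequence may fail to exist; a finer filter replaces it.\<close>

lemma exists_pointwise_limit_along_finer_filter:
  fixes q :: "'n \<Rightarrow> 'i \<Rightarrow> 'b::{complete_linorder,linorder_topology,second_countable_topology}"
  assumes "F \<noteq> bot"
  obtains U l where "U \<noteq> bot" "U \<le> F" "\<And>i. ((\<lambda>n. q n i) \<longlongrightarrow> l i) U"
proof -
  have "compact (UNIV :: ('i \<Rightarrow> 'b) set)"
  proof -
    have "compact_space (product_topology (\<lambda>i::'i. euclidean :: 'b topology) UNIV)"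
      unfolding compact_space_product_topology
      using compact_UNIV[where 'a='b] by (simp add: compact_space_def del: product_topology_trivial_iff)
    then show ?thesis
      by (simp add: euclidean_product_topology compact_space_def)
  qed
  moreover have "filtermap q F \<noteq> bot" using assms by (simp add: filtermap_bot_iff)
  ultimately obtain l where l: "inf (nhds l) (filtermap q F) \<noteq> bot"
    unfolding compact_filter by auto
  \<comment> \<open>Refining \<open>F\<close> by the preimages of the neighbourhoods of
    \<open>l\<close> forces convergence to \<open>l\<close>; the filter stays proper because
    \<open>l\<close> is a cluster point.\<close>
  define U where "U = inf (filtercomap q (nhds l)) F"
  have lim: "filterlim q (nhds l) U"
    unfolding U_def filterlim_iff_le_filtercomap by simp
  have "U \<noteq> bot"
  proof
    assume "U = bot"
    then have "eventually (\<lambda>_. False) U" by simp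
    then obtain P R where PR: "eventually P (filtercomap q (nhds l))" "eventually R F"
      "\<And>n. P n \<Longrightarrow> R n \<Longrightarrow> False" unfolding U_def eventually_inf by auto
    then obtain P' where P': "eventually P' (nhds l)" "\<And>n. P' (q n) \<Longrightarrow> P n"
      unfolding eventually_filtercomap by auto
    have "eventually (\<lambda>g. \<not> P' g) (filtermap q F)"
      unfolding eventually_filtermap using PR(2) by eventually_elim (use P' PR in blast)
    with P'(1) have "eventually (\<lambda>_. False) (inf (nhds l) (filtermap q F))"
      unfolding eventually_inf by blast
    with l show False by (simp add: eventually_False)
  qed
  moreover have "U \<le> F" by (simp add: U_def)
  moreover have "((\<lambda>n. q n i) \<longlongrightarrow> l i) U" for i
  proof -
    have "continuous_on UNIV (\<lambda>g::'i \<Rightarrow> 'b. g i)" by simp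
    then have "((\<lambda>g. g i) \<longlongrightarrow> l i) (nhds l)"
      unfolding continuous_on_def by (metis UNIV_I tendsto_at_iff_tendsto_nhds)
    from filterlim_compose[OF this lim] show ?thesis .
  qed
  ultimately show ?thesis using that by blast
qed

text \<open>Both measures may be infinite, so \<open>R\<close> cannot be defined by subtracting
  values. It is obtained by integrating \<open>1 - g\<close> against \<open>N\<close>, where
  \<open>g\<close> is the Radon-Nikodym density of \<open>P\<close>; the domination makes
  \<open>g\<close> at most 1 almost everywhere.\<close>

lemma diff_measure_exists:
  assumes N: "sigma_finite_measure N" and P: "sets P = sets N"
    and le: "\<And>A. A \<in> sets N \<Longrightarrow> emeasure P A \<le> emeasure N A"
  obtains R where "sets R = sets N" "\<And>A. A \<in> sets N \<Longrightarrow> emeasure N A = emeasure R A + emeasure P A"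
proof -
  interpret sigma_finite_measure N by fact
  have "absolutely_continuous N P"
    unfolding absolutely_continuous_def using le P by (auto simp: null_sets_def) (metis le_zero_eq)
  then obtain g where g[measurable]: "g \<in> borel_measurable N" and P_eq: "density N g = P"
    using Radon_Nikodym P by blast
  have Pg: "emeasure P A = (\<integral>\<^sup>+x. g x * indicator A x \<partial>N)" if "A \<in> sets N" for A
    unfolding P_eq[symmetric] using that by (simp add: emeasure_density)
  obtain A :: "nat \<Rightarrow> _" where A: "range A \<subseteq> sets N" "(\<Union>i. A i) = space N" "\<And>i. emeasure N (A i) \<noteq> \<infinity>"
    using sigma_finite by blast
  have "AE x in N. x \<in> A i \<longrightarrow> g x \<le> 1" for i
  proof -
    have [measurable]: "A i \<in> sets N" using A by auto
    \<comment> \<open>The part of \<open>A i\<close> on which the claim fails. Its measure is finite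
      and can be cancelled, which leaves 0 for the integral of the excess
      \<open>g - 1\<close>.\<close>
    define B where "B = {x\<in>space N. x \<in> A i \<and> 1 < g x}"
    have [measurable]: "B \<in> sets N" unfolding B_def by measurable
    have fin: "emeasure N B \<noteq> \<infinity>"
      using A(3)[of i] emeasure_mono[of B "A i" N] by (auto simp: B_def top_unique subset_eq)
    have "(\<integral>\<^sup>+x. (g x - 1) * indicator B x \<partial>N) + emeasure N B
        = (\<integral>\<^sup>+x. (g x - 1) * indicator B x + indicator B x \<partial>N)"
      by (subst nn_integral_add) auto
    also have "\<dots> = (\<integral>\<^sup>+x. g x * indicator B x \<partial>N)"
      by (intro nn_integral_cong) (auto simp: B_def indicator_def diff_add_cancel_ennreal)
    also have "\<dots> \<le> emeasure N B" using le[of B] by (simp add: Pg)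
    finally have "(\<integral>\<^sup>+x. (g x - 1) * indicator B x \<partial>N) = 0"
      using fin by (metis add.commute add_0_right ennreal_add_left_cancel_le infinity_ennreal_def le_zero_eq)
    then have "AE x in N. (g x - 1) * indicator B x = 0"
      by (subst (asm) nn_integral_0_iff_AE) auto
    then show ?thesis
      by (rule AE_mp) (auto intro!: AE_I2 simp: B_def indicator_def not_less diff_eq_0_iff_ennreal split: if_splits)
  qed
  then have "AE x in N. \<forall>i. x \<in> A i \<longrightarrow> g x \<le> 1"
    unfolding AE_all_countable by blast
  then have g1: "AE x in N. g x \<le> 1"
    using AE_space by eventually_elim (use A(2) in blast)
  show ?thesis
  proof (rule that[of "density N (\<lambda>x. 1 - g x)"])
    fix B assume [measurable]: "B \<in> sets N"
    have "emeasure N B = (\<integral>\<^sup>+x. indicator B x \<partial>N)" by simp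
    also have "\<dots> = (\<integral>\<^sup>+x. (1 - g x) * indicator B x + g x * indicator B x \<partial>N)"
      using g1 by (intro nn_integral_cong_AE) (auto simp: indicator_def diff_add_cancel_ennreal)
    also have "\<dots> = emeasure (density N (\<lambda>x. 1 - g x)) B + emeasure P B"
      by (subst nn_integral_add) (auto simp: Pg emeasure_density)
    finally show "emeasure N B = emeasure (density N (\<lambda>x. 1 - g x)) B + emeasure P B" .
  qed simp
qed

section \<open>Conservative nonsingular maps\<close>

locale conservative_system =
  fixes L :: "'a::topological_space measure" and f :: "'a \<Rightarrow> 'a"
  assumes L_borel: "sets L = sets borel"
    and f_borel[measurable]: "f \<in> borel_measurable borel"
    and nonsingular: "absolutely_continuous L (distr L borel f)"
    and conservative: "ergodic_conservative L f"
begin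

section \<open>Iterates, null sets and recurrence\<close>

lemma iterate_borel[measurable]: "f ^^ n \<in> borel_measurable borel"
  by (induction n) (auto simp: id_def[symmetric] comp_def)

lemma vimage_iterate_borel: "A \<in> sets borel \<Longrightarrow> (f ^^ n) -` A \<in> sets borel"
  using measurable_sets[OF iterate_borel, of A n] by simp

lemma vimage_borel: "A \<in> sets borel \<Longrightarrow> f -` A \<in> sets borel"
  using vimage_iterate_borel[of A 1] by simp

lemma vimage_vimage_iterate: "f -` ((f ^^ n) -` A) = (f ^^ Suc n) -` A"
  by (simp add: vimage_comp[symmetric] funpow_Suc_right del: funpow.simps)

lemma null_vimage:
  assumes "A \<in> sets borel" "emeasure L A = 0"
  shows "emeasure L (f -` A) = 0"
proof -
  have "space L = UNIV" using sets_eq_imp_space_eq[OF L_borel] by simp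
  moreover have "f \<in> measurable L borel"
    using f_borel L_borel by (simp cong: measurable_cong_sets)
  moreover have "emeasure (distr L borel f) A = 0"
    using absolutely_continuousD[OF nonsingular] assms L_borel by simp
  ultimately show ?thesis using assms by (simp add: emeasure_distr)
qed

lemma null_vimage_iterate:
  assumes "A \<in> sets borel" "emeasure L A = 0"
  shows "emeasure L ((f ^^ n) -` A) = 0"
proof (induction n)
  case (Suc n)
  with null_vimage[OF vimage_iterate_borel[OF assms(1)]] show ?case
    by (simp add: vimage_vimage_iterate del: funpow.simps)
qed (simp add: assms)

text \<open>Nonsingularity keeps every preimage of the exceptional set null, and there are only
  countably many of them.\<close>

lemma AE_iterate:
  assumes "AE x in L. P x"
  shows "AE x in L. \<forall>n. P ((f ^^ n) x)"
proof -
  from assms obtain Z where Z: "{x\<in>space L. \<not> P x} \<subseteq> Z" "emeasure L Z = 0" "Z \<in> sets L"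
    by (rule AE_E)
  have sp: "space L = UNIV" using sets_eq_imp_space_eq[OF L_borel] by simp
  have "AE x in L. P ((f ^^ n) x)" for n
    by (rule AE_I[of _ _ "(f ^^ n) -` Z"])
      (use Z sp null_vimage_iterate vimage_iterate_borel L_borel in auto)
  then show ?thesis by (simp add: AE_all_countable)
qed

text \<open>Almost surely the return property holds at all points of the orbit at once. As the
  return time is at least 1, every time \<open>m\<close> is followed by a strictly later
  visit.\<close>

lemma AE_infinitely_often:
  assumes "A \<in> sets borel" "emeasure L A > 0"
  shows "AE x in L. \<exists>\<^sub>\<infinity>n. (f ^^ n) x \<in> A"
proof -
  have "AE x in L. \<exists>n\<ge>1. (f ^^ n) x \<in> A"
    using conservative assms L_borel by (auto simp: ergodic_conservative_def)
  from AE_iterate[OF this] show ?thesis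
  proof (rule AE_mp, intro AE_I2 impI)
    fix x assume *: "\<forall>m. \<exists>n\<ge>1. (f ^^ n) ((f ^^ m) x) \<in> A"
    show "\<exists>\<^sub>\<infinity>n. (f ^^ n) x \<in> A"
      unfolding INFM_nat
    proof
      fix m
      obtain n where "n \<ge> 1" "(f ^^ n) ((f ^^ m) x) \<in> A" using * by blast
      then have "n + m > m" "(f ^^ (n + m)) x \<in> A" by (simp_all add: funpow_add)
      then show "\<exists>n>m. (f ^^ n) x \<in> A" by blast
    qed
  qed
qed

text \<open>If the sum were finite, Borel-Cantelli would allow \<open>R\<close>-almost every point
  only finitely many visits to \<open>A\<close>. Conservativity gives infinitely many, and both can
  hold only for the zero measure.\<close>

lemma orbit_sum_infinite:
  assumes R: "sets R = sets borel" "absolutely_continuous L R" "emeasure R UNIV \<noteq> 0"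
    and A: "A \<in> sets borel" "emeasure L A > 0"
  shows "(\<Sum>n. emeasure R ((f ^^ n) -` A)) = \<infinity>"
proof (rule ccontr)
  assume fin: "(\<Sum>n. emeasure R ((f ^^ n) -` A)) \<noteq> \<infinity>"
  have sp: "space R = UNIV" using sets_eq_imp_space_eq[OF R(1)] by simp
  have lt: "emeasure R ((f ^^ n) -` A) < \<infinity>" for n
    using ennreal_suminf_lessD[of "\<lambda>n. emeasure R ((f ^^ n) -` A)" "\<infinity>" n] fin
    by (simp add: less_top)
  then have "summable (\<lambda>n. measure R ((f ^^ n) -` A))"
    using fin by (intro summable_suminf_not_top) (auto simp: emeasure_eq_ennreal_measure less_top)
  then have "AE x in R. eventually (\<lambda>n. x \<in> space R - (f ^^ n) -` A) sequentially"
    using lt R(1) A vimage_iterate_borel by (intro borel_cantelli_AE1) auto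
  moreover have "AE x in R. \<exists>\<^sub>\<infinity>n. (f ^^ n) x \<in> A"
    using R L_borel AE_infinitely_often[OF A] by (intro absolutely_continuous_AE[of R L]) auto
  ultimately have "AE x in R. False"
  proof eventually_elim
    case (elim x)
    then obtain m where "\<And>n. n \<ge> m \<Longrightarrow> (f ^^ n) x \<notin> A" by (auto simp: eventually_sequentially)
    moreover obtain n where "n > m" "(f ^^ n) x \<in> A" using elim(2) by (auto simp: INFM_nat)
    ultimately show False using less_imp_le by blast
  qed
  then show False
    using R(3) sp ae_filter_eq_bot_iff[of R] by (simp add: eventually_False)
qed

text \<open>All terms of the divergent orbit series equal \<open>emeasure R A\<close>, which
  therefore cannot vanish. Thus \<open>L\<close> is in turn absolutely continuous with respect to
  \<open>R\<close>.\<close>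

lemma positive_on_positive_sets:
  assumes R: "sets R = sets borel" "absolutely_continuous L R" "emeasure R UNIV \<noteq> 0"
    and inv: "\<And>n A. A \<in> sets borel \<Longrightarrow> emeasure R ((f ^^ n) -` A) = emeasure R A"
    and A: "A \<in> sets borel" "emeasure L A > 0"
  shows "emeasure R A > 0"
proof (rule ccontr)
  assume "\<not> emeasure R A > 0"
  then have "(\<Sum>n. emeasure R ((f ^^ n) -` A)) = 0" using inv[OF A(1)] by simp
  with orbit_sum_infinite[OF R A] show False by simp
qed

text \<open>The mass lost under a preimage is itself a measure \<open>R\<close>. Its orbit series on
  the set \<open>A\<close> of finite measure telescopes and stays below \<open>emeasure N A\<close>,
  so divergence of orbit series leaves only \<open>R = 0\<close>.\<close>

lemma subinvariant_imp_invariant: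
  assumes N: "N \<in> sigma_finite_borel" "absolutely_continuous L N"
    and sub: "\<And>A. A \<in> sets borel \<Longrightarrow> emeasure N (f -` A) \<le> emeasure N A"
    and A: "A \<in> sets borel" "emeasure L A > 0" "emeasure N A < \<infinity>"
  shows "distr N borel f = N"
proof -
  have sN: "sets N = sets borel" and sf: "sigma_finite_measure N"
    using N by (auto simp: sigma_finite_borel_def)
  have sp: "space N = UNIV" using sets_eq_imp_space_eq[OF sN] by simp
  have mf: "f \<in> measurable N borel" using f_borel sN by (simp cong: measurable_cong_sets)
  have D: "emeasure (distr N borel f) B = emeasure N (f -` B)" if "B \<in> sets borel" for B
    using that mf sp by (simp add: emeasure_distr)
  obtain R where R: "sets R = sets N"
    "\<And>B. B \<in> sets N \<Longrightarrow> emeasure N B = emeasure R B + emeasure (distr N borel f) B"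
    using diff_measure_exists[OF sf, of "distr N borel f"] sub sN D by auto
  then have R': "emeasure N B = emeasure R B + emeasure N (f -` B)" if "B \<in> sets borel" for B
    using that sN D by simp
  have ac: "absolutely_continuous L R"
    unfolding absolutely_continuous_def
  proof
    fix B assume B: "B \<in> null_sets L"
    then have "emeasure N B = 0" using N(2) by (auto simp: absolutely_continuous_def)
    then show "B \<in> null_sets R" using B R' R(1) L_borel sN by (auto simp: null_sets_def)
  qed
  \<comment> \<open>The remainder is kept as a summand, so that no subtraction in
    \<open>ennreal\<close> occurs; dropping it bounds the partial sums.\<close>
  have tele: "(\<Sum>k<n. emeasure R ((f ^^ k) -` A)) + emeasure N ((f ^^ n) -` A) = emeasure N A" for n
  proof (induction n)
    case (Suc n)
    then show ?case
      using R'[OF vimage_iterate_borel[OF A(1), of n]]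
      by (simp add: vimage_vimage_iterate add.assoc del: funpow.simps)
  qed simp
  have "(\<Sum>k. emeasure R ((f ^^ k) -` A)) \<le> emeasure N A"
  proof (rule suminf_le_const[OF summableI])
    show "(\<Sum>k<n. emeasure R ((f ^^ k) -` A)) \<le> emeasure N A" for n
      unfolding tele[of n, symmetric] by simp
  qed
  then have R0: "emeasure R UNIV = 0"
    using orbit_sum_infinite[of R A] R(1) sN ac A by (metis infinity_ennreal_def leD)
  show ?thesis
  proof (rule measure_eqI)
    fix B assume "B \<in> sets (distr N borel f)"
    then have B: "B \<in> sets borel" by simp
    have "emeasure R B \<le> emeasure R UNIV" using R(1) sN by (intro emeasure_mono) auto
    with R0 R'[OF B] D[OF B] show "emeasure (distr N borel f) B = emeasure N B" by simp
  qed (simp add: sN)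
qed

end

section \<open>From an invariant measure to a partition\<close>

text \<open>The supremum in inner regularity is reached along a sequence of compact Borel sets.
  Their union has the measure of \<open>B\<close>, and finiteness of \<open>L\<close> makes the
  difference null.\<close>

lemma sigma_compact_almost_all:
  assumes L: "sets L = sets borel" "finite_measure L" "inner_regular_compact L"
    and B: "B \<in> sets borel"
  obtains F where "F \<subseteq> B" "F \<in> sets borel" "sigma_compact F" "emeasure L (B - F) = 0"
proof -
  interpret finite_measure L by fact
  let ?C = "{K. K \<in> sets borel \<and> compact K \<and> K \<subseteq> B}"
  have eq: "emeasure L B = (SUP K\<in>?C. emeasure L K)"
    using L(3) B by (simp add: inner_regular_compact_def)
  have "?C \<noteq> {}" by (auto intro!: exI[of _ "{}"])
  from ennreal_SUP_countable_SUP[OF this, of "emeasure L"]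
  obtain v :: "nat \<Rightarrow> ennreal" where v: "range v \<subseteq> emeasure L ` ?C" "(SUP K\<in>?C. emeasure L K) = (SUP n. v n)"
    by auto
  then have "\<forall>n. \<exists>K. K \<in> ?C \<and> v n = emeasure L K" by (auto simp: image_subset_iff image_iff)
  then obtain k where k: "\<And>n. k n \<in> ?C" "\<And>n. v n = emeasure L (k n)" by metis
  define F where "F = (\<Union>n. k n)"
  have F: "F \<subseteq> B" "F \<in> sets borel" using k(1) by (auto simp: F_def)
  have "v n \<le> emeasure L F" for n
    unfolding k(2) using F L(1) by (intro emeasure_mono) (auto simp: F_def)
  then have "emeasure L B \<le> emeasure L F" unfolding eq v(2) by (rule SUP_least)
  then have "emeasure L (B - F) = 0"
    using F B L(1) by (subst emeasure_Diff) (auto simp: diff_eq_0_iff_ennreal less_top[symmetric])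
  moreover have "sigma_compact F"
    unfolding sigma_compact_def F_def using k(1) by (intro exI[of _ "range k"]) auto
  ultimately show ?thesis using F that by blast
qed

section \<open>Density bounds for an invariant measure\<close>

context conservative_system
begin

lemma invariant_iterate:
  assumes "sets M = sets borel" "distr M borel f = M" "A \<in> sets borel"
  shows "emeasure M ((f ^^ n) -` A) = emeasure M A"
proof (induction n)
  case (Suc n)
  have "space M = UNIV" using sets_eq_imp_space_eq[OF assms(1)] by simp
  moreover have "f \<in> measurable M borel" using f_borel assms(1) by (simp cong: measurable_cong_sets)
  ultimately have "emeasure M (f -` ((f ^^ n) -` A)) = emeasure (distr M borel f) ((f ^^ n) -` A)"
    using vimage_iterate_borel[OF assms(3)] by (simp add: emeasure_distr)
  with Suc show ?case by (simp only: assms(2) vimage_vimage_iterate)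
qed simp

text \<open>The \<open>H k\<close> are bands of values of the density of \<open>M\<close>. They
  cover almost everything: the density is finite because \<open>M\<close> is \<sigma>-finite, and
  nonzero because an invariant nonzero \<open>M\<close> charges every set of positive
  \<open>L\<close>-measure.\<close>

lemma invariant_imp_bounded_density_cover:
  assumes "prob_space L"
    and M: "M \<in> sigma_finite_borel" "absolutely_continuous L M" "distr M borel f = M" "emeasure M UNIV \<noteq> 0"
  obtains H :: "nat \<Rightarrow> 'a set" where "range H \<subseteq> sets borel" "emeasure L (UNIV - (\<Union>k. H k)) = 0"
    "\<And>k A. A \<in> sets borel \<Longrightarrow> A \<subseteq> H k \<Longrightarrow>
       ennreal (1 / Suc k) * emeasure L A \<le> emeasure M A \<and> emeasure M A \<le> ennreal (Suc k) * emeasure L A"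
proof -
  interpret prob_space L by fact
  have sM: "sets M = sets borel" and sf: "sigma_finite_measure M"
    using M by (auto simp: sigma_finite_borel_def)
  have spL: "space L = UNIV" using sets_eq_imp_space_eq[OF L_borel] by simp
  define h where "h = RN_deriv L M"
  have h[measurable]: "h \<in> borel_measurable L" by (simp add: h_def)
  have "density L h = M" unfolding h_def using M(2) sM L_borel by (intro density_RN_deriv) auto
  then have Mh: "emeasure M A = (\<integral>\<^sup>+x. h x * indicator A x \<partial>L)" if "A \<in> sets borel" for A
    using that L_borel emeasure_density[OF h, of A] by simp
  have h_fin: "AE x in L. h x \<noteq> \<infinity>"
    unfolding h_def using sf M(2) sM L_borel by (intro RN_deriv_finite) auto
  have "{x. h x = 0} \<in> sets L" using spL borel_measurable_vimage[OF h, of 0] by (simp add: vimage_def)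
  then have Z: "{x. h x = 0} \<in> sets borel" by (simp add: L_borel)
  have "emeasure M {x. h x = 0} = 0" unfolding Mh[OF Z]
    by (rule nn_integral_zero') (auto intro!: AE_I2 simp: indicator_def)
  then have "emeasure L {x. h x = 0} = 0"
    using positive_on_positive_sets[OF sM M(2,4) invariant_iterate[OF sM M(3)] Z]
    by (metis less_irrefl not_gr_zero)
  then have h_pos: "AE x in L. h x \<noteq> 0"
    using Z L_borel spL by (intro AE_I[where N="{x. h x = 0}"]) auto
  define H where "H k = {x. ennreal (1 / Suc k) \<le> h x \<and> h x \<le> ennreal (Suc k)}" for k :: nat
  have H: "H k \<in> sets borel" for k
  proof -
    have "{x\<in>space L. ennreal (1 / Suc k) \<le> h x \<and> h x \<le> ennreal (Suc k)} \<in> sets L" by measurable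
    then show ?thesis by (simp add: H_def spL L_borel)
  qed
  have cover: "\<exists>k. x \<in> H k" if "h x \<noteq> 0" "h x \<noteq> \<infinity>" for x
  proof -
    from that obtain r where r: "h x = ennreal r" "r > 0"
      by (cases "h x") (auto simp: order_le_less)
    obtain m where m: "1 / real (Suc m) < r" using nat_approx_posE[OF r(2)] by blast
    obtain n where n: "r \<le> real n" using real_arch_simple by blast
    \<comment> \<open>The bands grow with the index, so the larger of the two indices meets both the
      lower and the upper bound.\<close>
    have "1 / real (Suc (max m n)) \<le> 1 / real (Suc m)" by (intro divide_left_mono) auto
    then have "ennreal (1 / real (Suc (max m n))) \<le> ennreal r" "ennreal r \<le> ennreal (real (Suc (max m n)))"
      using m n by (auto intro!: ennreal_leI simp del: of_nat_Suc)
    then have "x \<in> H (max m n)" by (simp only: H_def r(1) mem_Collect_eq simp_thms)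
    then show ?thesis ..
  qed
  have "AE x in L. x \<notin> UNIV - (\<Union>k. H k)"
    using h_pos h_fin by eventually_elim (use cover in blast)
  then have "emeasure L (UNIV - (\<Union>k. H k)) = 0"
    using H L_borel spL by (subst (asm) AE_iff_measurable[where N="UNIV - (\<Union>k. H k)"]) auto
  moreover have "ennreal (1 / Suc k) * emeasure L A \<le> emeasure M A \<and> emeasure M A \<le> ennreal (Suc k) * emeasure L A"
    if A: "A \<in> sets borel" "A \<subseteq> H k" for k A
  proof
    have [simp]: "A \<in> sets L" using A L_borel by simp
    have "(\<integral>\<^sup>+x. ennreal (1 / Suc k) * indicator A x \<partial>L) \<le> emeasure M A"
      unfolding Mh[OF A(1)] using A(2) by (intro nn_integral_mono) (auto simp: H_def indicator_def)
    then show "ennreal (1 / Suc k) * emeasure L A \<le> emeasure M A"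
      by (subst (asm) nn_integral_cmult_indicator) auto
    have "emeasure M A \<le> (\<integral>\<^sup>+x. ennreal (Suc k) * indicator A x \<partial>L)"
      unfolding Mh[OF A(1)] using A(2) by (intro nn_integral_mono) (auto simp: H_def indicator_def)
    then show "emeasure M A \<le> ennreal (Suc k) * emeasure L A"
      by (subst (asm) nn_integral_cmult_indicator) auto
  qed
  ultimately show ?thesis using that[of H] H by blast
qed

text \<open>Invariance removes the iterate from all three conditions, which then only compare
  \<open>M\<close> with \<open>L\<close> on subsets of \<open>F\<close>.\<close>

lemma invariant_m1_m2_m3:
  assumes "prob_space L" and M: "sets M = sets borel" "distr M borel f = M"
    and F: "F \<in> sets borel" "emeasure L F > 0" and c: "c \<ge> 1"
    and bounds: "\<And>A. A \<in> sets borel \<Longrightarrow> A \<subseteq> F \<Longrightarrow>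
       ennreal (1 / c) * emeasure L A \<le> emeasure M A \<and> emeasure M A \<le> ennreal c * emeasure L A"
  shows "(\<exists>K>0. m1 M F K \<and> m2 L f M F K) \<and> m3 f M F"
proof -
  interpret prob_space L by fact
  note inv = invariant_iterate[OF M]
  have inv': "measure M ((f ^^ n) -` A) = measure M A" if "A \<in> sets borel" for n A
    using inv[OF that] by (simp add: measure_def)
  define l where "l = measure L F"
  have l: "0 < l" "l \<le> 1"
    using F prob_le_1 by (auto simp: l_def emeasure_eq_measure)
  have fin: "emeasure M A < \<infinity>" if "A \<in> sets borel" "A \<subseteq> F" for A
    using conjunct2[OF bounds[OF that]] by (auto simp: emeasure_eq_measure ennreal_mult_less_top intro: le_less_trans)
  have real_bounds: "measure L A / c \<le> measure M A \<and> measure M A \<le> c * measure L A"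
    if "A \<in> sets borel" "A \<subseteq> F" for A
  proof -
    have "emeasure M A = ennreal (measure M A)"
      using fin[OF that] by (intro emeasure_eq_ennreal_measure) auto
    with bounds[OF that] c show ?thesis
      by (simp add: emeasure_eq_measure ennreal_mult[symmetric])
  qed
  \<comment> \<open>The ratios \<open>M A / M F\<close> and \<open>L A / L F\<close> differ at most
    by the factor \<open>c^2\<close>. Dividing by \<open>l \<le> 1\<close> only enlarges this
    constant and makes it serve \<open>m1\<close> too, where
    \<open>l / c \<le> m \<le> c * l\<close>.\<close>
  define K where "K = c^2 / l"
  have K: "K > 0" using c l by (simp add: K_def)
  define m where "m = measure M F"
  have m: "l / c \<le> m" "m \<le> c * l" using real_bounds[of F] F by (auto simp: m_def l_def)
  then have m0: "m > 0" using l c by (meson divide_pos_pos less_le_trans zero_less_one)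
  have Mm: "emeasure M F = ennreal m"
    unfolding m_def using fin[of F] F by (intro emeasure_eq_ennreal_measure) auto
  have "l \<le> 1 * c" using l c by linarith
  then have "l / c\<^sup>2 \<le> l / c" "c * l \<le> c\<^sup>2 / l"
    using l c mult_mono[of l 1 l 1] by (auto simp: field_simps power2_eq_square)
  then have "m1 M F K"
    unfolding m1_def Mm using m by (auto simp: K_def intro!: ennreal_leI)
  moreover have "m2 L f M F K"
    unfolding m2_def
  proof (intro allI conjI ballI impI)
    show "0 < emeasure M ((f ^^ n) -` F)" "emeasure M ((f ^^ n) -` F) < \<infinity>" for n
      using m0 by (simp_all add: inv[OF F(1)] Mm)
  next
    fix n A assume A: "A \<in> sets borel" "A \<subseteq> F"
    define a where "a = measure L A"
    define b where "b = measure M A"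
    have a: "0 \<le> a" "0 \<le> b" "a / c \<le> b" "b \<le> c * a"
      using real_bounds[OF A] by (auto simp: a_def b_def)
    have "1 / K * (a / l) = (a / c) / c" using l by (simp add: K_def power2_eq_square)
    also have "\<dots> \<le> (a / c) / (c * l)" using a c l by (intro divide_left_mono) auto
    also have "\<dots> \<le> b / m" using a c l m m0 by (intro frac_le) auto
    finally show "1 / K * (measure L A / measure L F) \<le> measure M ((f ^^ n) -` A) / measure M ((f ^^ n) -` F)"
      by (simp add: inv' A F a_def b_def l_def m_def)
    have "b / m \<le> (c * a) / (l / c)" using a c l m m0 by (intro frac_le) auto
    also have "\<dots> = c\<^sup>2 * a / l" by (simp add: power2_eq_square)
    also have "\<dots> \<le> c\<^sup>2 * a / l / l" using a c l by (simp add: pos_le_divide_eq mult_left_le)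
    also have "\<dots> = K * (a / l)" by (simp add: K_def)
    finally show "measure M ((f ^^ n) -` A) / measure M ((f ^^ n) -` F) \<le> K * (measure L A / measure L F)"
      by (simp add: inv' A F a_def b_def l_def m_def)
  qed
  moreover have "m3 f M F" using inv[OF F(1)] Mm by (simp add: m3_def)
  ultimately show ?thesis using K by blast
qed

text \<open>The density bands are made disjoint and then shrunk to \<sigma>-compact subsets. Only
  null sets are lost, and the density bounds pass to subsets.\<close>

lemma invariant_imp_partition:
  assumes L: "prob_space L" "inner_regular_compact L"
    and M: "M \<in> sigma_finite_borel" "absolutely_continuous L M" "distr M borel f = M" "emeasure M UNIV \<noteq> 0"
  shows "\<exists>\<G>. measure_partition L \<G> \<and> M \<in> MM_s L \<G> f"
proof -
  interpret prob_space L by fact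
  have sM: "sets M = sets borel" using M by (auto simp: sigma_finite_borel_def)
  obtain H :: "nat \<Rightarrow> 'a set" where H: "range H \<subseteq> sets borel" "emeasure L (UNIV - (\<Union>k. H k)) = 0"
    "\<And>k A. A \<in> sets borel \<Longrightarrow> A \<subseteq> H k \<Longrightarrow>
       ennreal (1 / Suc k) * emeasure L A \<le> emeasure M A \<and> emeasure M A \<le> ennreal (Suc k) * emeasure L A"
    using invariant_imp_bounded_density_cover[OF L(1) M] by blast
  define E where "E = disjointed H"
  have E: "E k \<in> sets borel" "E k \<subseteq> H k" for k
    using sets.range_disjointed_sets[OF H(1)] disjointed_subset[of H] by (auto simp: E_def)
  have UE: "(\<Union>k. E k) = (\<Union>k. H k)" by (simp add: E_def UN_disjointed_eq)
  have "\<forall>k. \<exists>F. F \<subseteq> E k \<and> F \<in> sets borel \<and> sigma_compact F \<and> emeasure L (E k - F) = 0"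
    using sigma_compact_almost_all[OF L_borel finite_measure_axioms L(2) E(1)] by metis
  then obtain F where F: "\<And>k. F k \<subseteq> E k" "\<And>k. F k \<in> sets borel" "\<And>k. sigma_compact (F k)"
      "\<And>k. emeasure L (E k - F k) = 0" by metis
  have dF: "disjoint_family_on F S" for S
    using F(1) disjoint_family_disjointed[of H]
    unfolding E_def disjoint_family_on_def by blast
  \<comment> \<open>Null pieces, among them empty ones, are dropped because a partition has only
    pieces of positive measure. The null set \<open>Z k\<close> collects what \<open>E k\<close>
    loses here and in passing to \<open>F k\<close>.\<close>
  define \<G> where "\<G> = F ` {k. emeasure L (F k) > 0}"
  define Z where "Z k = (E k - F k) \<union> (if emeasure L (F k) = 0 then F k else {})" for k
  have Z: "Z k \<in> null_sets L" for k
    using F E L_borel unfolding Z_def by (intro null_sets.Un) (auto simp: null_sets_def)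
  have "UNIV - \<Union>\<G> \<subseteq> (UNIV - (\<Union>k. H k)) \<union> (\<Union>k. Z k)"
  proof
    fix x assume x: "x \<in> UNIV - \<Union>\<G>"
    show "x \<in> (UNIV - (\<Union>k. H k)) \<union> (\<Union>k. Z k)"
    proof (cases "\<exists>k. x \<in> E k")
      case True
      then obtain k where "x \<in> E k" by blast
      with x have "x \<in> Z k" by (auto simp: Z_def \<G>_def zero_less_iff_neq_zero)
      then show ?thesis by blast
    next
      case False
      with UE show ?thesis by blast
    qed
  qed
  moreover have "(UNIV - (\<Union>k. H k)) \<union> (\<Union>k. Z k) \<in> null_sets L"
    using H(1,2) Z L_borel by (intro null_sets.Un null_sets_UN) (auto simp: null_sets_def)
  moreover have "UNIV - \<Union>\<G> \<in> sets L"
    using F(2) by (auto simp: L_borel \<G>_def intro!: sets.countable_UN')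
  ultimately have "emeasure L (UNIV - \<Union>\<G>) = 0" by (meson null_setsD1 null_sets_subset)
  then have "measure_partition L \<G>"
    unfolding measure_partition_def
    using F disjoint_family_on_disjoint_image[OF dF]
    by (auto simp: \<G>_def less_top[symmetric])
  moreover have "M \<in> MM_s L \<G> f"
  proof -
    have "(\<exists>K>0. m1 M (F k) K \<and> m2 L f M (F k) K) \<and> m3 f M (F k)" if "emeasure L (F k) > 0" for k
    proof (rule invariant_m1_m2_m3[OF L(1) sM M(3) F(2) that, of "real (Suc k)"])
      fix A assume "A \<in> sets borel" "A \<subseteq> F k"
      then show "ennreal (1 / real (Suc k)) * emeasure L A \<le> emeasure M A \<and>
           emeasure M A \<le> ennreal (real (Suc k)) * emeasure L A"
        using H(3)[of A k] F(1)[of k] E(2)[of k] by blast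
    qed simp
    then show ?thesis using M by (auto simp: MM_s_def MM_def \<G>_def)
  qed
  ultimately show ?thesis by blast
qed

end

section \<open>From a partition to an invariant measure\<close>

text \<open>For a finite additive function, continuity along sequences decreasing to the empty set
  suffices. There \<open>c * emeasure L\<close> tends to 0 because \<open>L\<close> is
  finite.\<close>

lemma dominated_additive_imp_countably_additive:
  fixes \<mu> :: "'a set \<Rightarrow> ennreal"
  assumes L: "finite_measure L" and pos: "\<mu> {} = 0"
    and add: "\<And>A B. A \<in> sets L \<Longrightarrow> B \<in> sets L \<Longrightarrow> A \<inter> B = {} \<Longrightarrow> \<mu> (A \<union> B) = \<mu> A + \<mu> B"
    and dom: "\<And>A. A \<in> sets L \<Longrightarrow> \<mu> A \<le> c * emeasure L A" and c: "c < \<infinity>"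
  shows "countably_additive (sets L) \<mu>"
proof (rule sets.empty_continuous_imp_countably_additive)
  interpret finite_measure L by fact
  show "positive (sets L) \<mu>" using pos by (simp add: positive_def)
  show "additive (sets L) \<mu>" using add by (simp add: additive_def)
  show "\<forall>A\<in>sets L. \<mu> A \<noteq> \<infinity>"
  proof
    fix A assume A: "A \<in> sets L"
    have "c * emeasure L A < \<infinity>" using c by (auto simp: ennreal_mult_eq_top_iff less_top[symmetric])
    with dom[OF A] show "\<mu> A \<noteq> \<infinity>" by (metis leD)
  qed
  fix A :: "nat \<Rightarrow> 'a set" assume A: "range A \<subseteq> sets L" "decseq A" "(\<Inter>i. A i) = {}"
  have "(\<lambda>i. emeasure L (A i)) \<longlonglongrightarrow> emeasure L (\<Inter>i. A i)"
    using A(1,2) by (intro Lim_emeasure_decseq) auto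
  then have "(\<lambda>i. emeasure L (A i)) \<longlonglongrightarrow> 0" unfolding A(3) by simp
  then have "(\<lambda>i. c * emeasure L (A i)) \<longlonglongrightarrow> c * 0" using c by (intro ennreal_tendsto_cmult) auto
  then have lim: "(\<lambda>i. c * emeasure L (A i)) \<longlonglongrightarrow> 0" by simp
  have "\<forall>\<^sub>F i in sequentially. \<mu> (A i) \<le> c * emeasure L (A i)" using A(1) dom by auto
  from tendsto_sandwich[OF _ this tendsto_const lim]
  show "(\<lambda>i. \<mu> (A i)) \<longlonglongrightarrow> 0" by simp
qed

text \<open>The exchange of integral and series, read for the counting measure.\<close>

lemma suminf_swap_ennreal:
  fixes g :: "nat \<Rightarrow> nat \<Rightarrow> ennreal"
  shows "(\<Sum>i. \<Sum>j. g i j) = (\<Sum>j. \<Sum>i. g i j)"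
proof -
  have "(\<Sum>i. \<Sum>j. g i j) = (\<integral>\<^sup>+i. (\<Sum>j. g i j) \<partial>count_space UNIV)"
    by (simp add: nn_integral_count_space_nat)
  also have "\<dots> = (\<Sum>j. \<integral>\<^sup>+i. g i j \<partial>count_space UNIV)" by (rule nn_integral_suminf) simp
  finally show ?thesis by (simp add: nn_integral_count_space_nat)
qed

text \<open>A sequence is wanted even for finite \<open>\<G>\<close>, so an enumeration may repeat
  pieces. Disjointing it turns each repetition into the empty set and leaves every first occurrence
  intact.\<close>

lemma measure_partition_enumeration:
  assumes "measure_partition L \<G>"
  obtains J :: "nat \<Rightarrow> 'a::topological_space set"
  where "disjoint_family J" "\<And>i. J i = {} \<or> J i \<in> \<G>" "\<Union>\<G> = (\<Union>i. J i)" "\<And>I. I \<in> \<G> \<Longrightarrow> \<exists>i. I = J i"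
proof (cases "\<G> = {}")
  case True
  then show ?thesis using that[of "\<lambda>_. {}"] by (auto simp: disjoint_family_on_def)
next
  case False
  have c: "countable \<G>" and d: "disjoint \<G>" using assms by (auto simp: measure_partition_def)
  define e where "e = from_nat_into \<G>"
  have e: "range e = \<G>" using False c by (simp add: e_def range_from_nat_into)
  then have eG: "e i \<in> \<G>" for i by blast
  have *: "disjointed e i = {} \<or> disjointed e i = e i" for i
  proof (cases "\<exists>j<i. e j = e i")
    case True
    then show ?thesis by (auto simp: disjointed_def)
  next
    case False
    then have "e i \<inter> e j = {}" if "j < i" for j
      using that d eG unfolding disjoint_def by metis
    then show ?thesis unfolding disjointed_def by fastforce
  qed
  show ?thesis
  proof (rule that[of "disjointed e"])
    show "disjoint_family (disjointed e)" by (rule disjoint_family_disjointed)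
    show "disjointed e i = {} \<or> disjointed e i \<in> \<G>" for i using *[of i] eG by auto
    show "\<Union>\<G> = (\<Union>i. disjointed e i)" by (simp add: UN_disjointed_eq e)
    fix I assume "I \<in> \<G>"
    then have "\<exists>i. e i = I" using e by blast
    then have le: "e (LEAST i. e i = I) = I" by (rule LeastI_ex)
    define i where "i = (LEAST i. e i = I)"
    have "e j \<noteq> e i" if "j < i" for j using not_less_Least[of j "\<lambda>i. e i = I"] that le by (auto simp: i_def)
    then have "e i \<inter> e j = {}" if "j < i" for j
      using that d eG unfolding disjoint_def by metis
    then have "disjointed e i = e i" unfolding disjointed_def by fastforce
    then show "\<exists>i. I = disjointed e i" using le unfolding i_def by metis
  qed
qed

text \<open>The quotient bounds of \<open>m2\<close> with denominators cleared, in a form that can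
  be summed over \<open>n\<close>.\<close>

lemma m2_bounds:
  assumes L: "prob_space L" "emeasure L I > 0" and K: "K > 0"
    and sM: "sets M = sets borel" and meas: "(f ^^ n) -` I \<in> sets borel"
    and m2: "m2 L f M I K" and A: "A \<in> sets borel" "A \<subseteq> I"
  shows "emeasure M ((f ^^ n) -` A) \<le> ennreal (K / measure L I) * emeasure L A * emeasure M ((f ^^ n) -` I)"
    and "emeasure L A * emeasure M ((f ^^ n) -` I) \<le> ennreal (K * measure L I) * emeasure M ((f ^^ n) -` A)"
proof -
  interpret prob_space L by fact
  define l a m b where "l = measure L I" and "a = measure L A"
    and "m = measure M ((f ^^ n) -` I)" and "b = measure M ((f ^^ n) -` A)"
  have pos: "0 < emeasure M ((f ^^ n) -` I)" and fin: "emeasure M ((f ^^ n) -` I) < \<infinity>"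
    and lower: "1 / K * (a / l) \<le> b / m" and upper: "b / m \<le> K * (a / l)"
    using m2 A unfolding m2_def l_def a_def m_def b_def by blast+
  have Mm: "emeasure M ((f ^^ n) -` I) = ennreal m"
    unfolding m_def using fin by (intro emeasure_eq_ennreal_measure) auto
  have "emeasure M ((f ^^ n) -` A) \<le> emeasure M ((f ^^ n) -` I)"
    using A(2) meas sM by (intro emeasure_mono) auto
  then have Mb: "emeasure M ((f ^^ n) -` A) = ennreal b"
    unfolding b_def using fin by (intro emeasure_eq_ennreal_measure) (auto simp: top_unique)
  have La: "emeasure L A = ennreal a" by (simp add: a_def emeasure_eq_measure)
  have nn: "0 \<le> a" "0 \<le> b" "0 < m" "0 < l"
    using pos L(2) Mm by (auto simp: a_def b_def l_def emeasure_eq_measure)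
  have "b \<le> K / l * a * m" using upper nn K by (simp add: field_simps)
  then show "emeasure M ((f ^^ n) -` A) \<le> ennreal (K / measure L I) * emeasure L A * emeasure M ((f ^^ n) -` I)"
    unfolding Mb La Mm l_def[symmetric] using nn K by (simp add: ennreal_mult[symmetric])
  have "a * m \<le> K * l * b" using lower nn K by (simp add: field_simps)
  then show "emeasure L A * emeasure M ((f ^^ n) -` I) \<le> ennreal (K * measure L I) * emeasure M ((f ^^ n) -` A)"
    unfolding Mb La Mm l_def[symmetric] using nn K by (simp add: ennreal_mult[symmetric])
qed

section \<open>Sums of measures along preimages and their limits\<close>

context conservative_system
begin

text \<open>Up to the factor \<open>1 / n\<close> this is the Cesaro average of the push-forwards of
  \<open>M\<close>. Only ratios of such sums enter the limit, where that factor cancels.\<close>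

definition orbit_sum :: "'a measure \<Rightarrow> nat \<Rightarrow> 'a set \<Rightarrow> ennreal" where
  "orbit_sum M n A = (\<Sum>k<n. emeasure M ((f ^^ k) -` A))"

lemma orbit_sum_mono:
  assumes "sets M = sets borel" "A \<subseteq> B" "B \<in> sets borel"
  shows "orbit_sum M n A \<le> orbit_sum M n B"
  unfolding orbit_sum_def using assms vimage_iterate_borel
  by (intro sum_mono emeasure_mono) auto

lemma orbit_sum_Un:
  assumes "sets M = sets borel" "A \<in> sets borel" "B \<in> sets borel" "A \<inter> B = {}"
  shows "orbit_sum M n (A \<union> B) = orbit_sum M n A + orbit_sum M n B"
proof -
  have "emeasure M ((f ^^ k) -` (A \<union> B)) = emeasure M ((f ^^ k) -` A) + emeasure M ((f ^^ k) -` B)" for k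
    using assms vimage_iterate_borel by (subst plus_emeasure) (auto simp: vimage_Un)
  then show ?thesis by (simp add: orbit_sum_def sum.distrib)
qed

text \<open>The preimage shifts the window of summation by \<open>j\<close>; terms of index at least
  \<open>n\<close> account for the excess.\<close>

lemma orbit_sum_vimage_iterate_le:
  "orbit_sum M n ((f ^^ j) -` A) \<le> orbit_sum M n A + (\<Sum>k\<in>{n..<n+j}. emeasure M ((f ^^ k) -` A))"
proof -
  have "orbit_sum M n ((f ^^ j) -` A) = (\<Sum>k<n. emeasure M ((f ^^ (k + j)) -` A))"
    unfolding orbit_sum_def by (intro sum.cong refl) (simp add: funpow_add vimage_comp add.commute[of _ j])
  also have "\<dots> = (\<Sum>k\<in>{j..<n + j}. emeasure M ((f ^^ k) -` A))"
    using sum.shift_bounds_nat_ivl[of "\<lambda>k. emeasure M ((f ^^ k) -` A)" 0 j n]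
    by (simp add: atLeast0LessThan)
  also have "\<dots> \<le> (\<Sum>k\<in>{..<n} \<union> {n..<n + j}. emeasure M ((f ^^ k) -` A))"
    by (intro sum_mono2) auto
  also have "\<dots> = orbit_sum M n A + (\<Sum>k\<in>{n..<n+j}. emeasure M ((f ^^ k) -` A))"
    unfolding orbit_sum_def by (intro sum.union_disjoint) auto
  finally show ?thesis .
qed

lemma MM_sD:
  assumes "measure_partition L \<G>" "M \<in> MM_s L \<G> f"
  shows "sets M = sets borel" "absolutely_continuous L M" "sigma_finite_measure M"
    and "I \<in> \<G> \<Longrightarrow> I \<in> sets borel" "I \<in> \<G> \<Longrightarrow> emeasure L I > 0"
    and "I \<in> \<G> \<Longrightarrow> 0 < emeasure M ((f ^^ n) -` I)"
    and "I \<in> \<G> \<Longrightarrow> emeasure M ((f ^^ n) -` I) < \<infinity>"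
    and "I \<in> \<G> \<Longrightarrow> \<exists>C<\<infinity>. \<forall>n. emeasure M ((f ^^ n) -` I) \<le> C"
    and "I \<in> \<G> \<Longrightarrow> \<exists>K>0. m2 L f M I K"
  using assms
  apply (auto simp: MM_s_def MM_def sigma_finite_borel_def measure_partition_def)
  subgoal by (auto simp: m2_def)
  subgoal by (auto simp: m2_def)
  subgoal by (auto simp: m3_def intro!: exI[of _ "SUP n. emeasure M ((f ^^ n) -` I)"] SUP_upper)
  done

text \<open>The constant of \<open>m2\<close> is the same for all iterates, so the bound survives
  summation.\<close>

lemma orbit_sum_dominated:
  assumes L: "prob_space L" and G: "measure_partition L \<G>" "M \<in> MM_s L \<G> f" and I: "I \<in> \<G>"
  shows "\<exists>c<\<infinity>. \<forall>A\<in>sets borel. A \<subseteq> I \<longrightarrow> (\<forall>n. orbit_sum M n A \<le> c * emeasure L A * orbit_sum M n I)"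
proof -
  note * = MM_sD[OF G]
  obtain K where K: "K > 0" "m2 L f M I K" using *(9)[OF I] by blast
  have "orbit_sum M n A \<le> ennreal (K / measure L I) * emeasure L A * orbit_sum M n I"
    if "A \<in> sets borel" "A \<subseteq> I" for A n
    unfolding orbit_sum_def sum_distrib_left
    using that by (intro sum_mono m2_bounds(1)[OF L *(5)[OF I] K(1) *(1) vimage_iterate_borel[OF *(4)[OF I]] K(2)])
  then show ?thesis by (intro exI[of _ "ennreal (K / measure L I)"]) auto
qed

text \<open>Some part of \<open>I\<close> of positive measure enters \<open>I'\<close> after a fixed
  time \<open>j\<close>. By \<open>m2\<close> it carries a fixed proportion of the sums over
  \<open>I\<close>, and by \<open>m3\<close> the time shift costs a bounded amount.\<close>

lemma orbit_sum_comparable: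
  assumes L: "prob_space L" and G: "measure_partition L \<G>" "M \<in> MM_s L \<G> f" and I: "I \<in> \<G>" "I' \<in> \<G>"
  shows "\<exists>D<\<infinity>. \<forall>n. orbit_sum M n I \<le> D * orbit_sum M n I'"
proof -
  interpret prob_space L by fact
  note * = MM_sD[OF G]
  have spL: "space L = UNIV" using sets_eq_imp_space_eq[OF L_borel] by simp
  obtain K where K: "K > 0" "m2 L f M I K" using *(9)[OF I(1)] by blast
  obtain C where C: "C < \<infinity>" "\<And>n. emeasure M ((f ^^ n) -` I') \<le> C" using *(8)[OF I(2)] by blast
  \<comment> \<open>The points of \<open>I\<close> that lie in \<open>I'\<close> after
    \<open>j\<close> steps. If all these sets were null, almost no point of \<open>I\<close> would
    ever reach \<open>I'\<close>, against conservativity.\<close>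
  define a where "a j = I \<inter> (f ^^ j) -` I'" for j
  have a: "a j \<in> sets borel" "a j \<subseteq> I" for j
    using *(4) I vimage_iterate_borel by (auto simp: a_def)
  have "\<exists>j. emeasure L (a j) > 0"
  proof (rule ccontr)
    assume "\<not> ?thesis"
    then have "a j \<in> null_sets L" for j using a L_borel by (auto simp: null_sets_def)
    then have "AE x in L. x \<notin> a j" for j by (rule AE_not_in)
    then have "AE x in L. \<forall>j. x \<notin> a j" by (simp add: AE_all_countable)
    moreover have "AE x in L. \<exists>n\<ge>1. (f ^^ n) x \<in> I'"
      using conservative *(4,5)[OF I(2)] L_borel by (auto simp: ergodic_conservative_def)
    ultimately have "AE x in L. x \<notin> I" by eventually_elim (auto simp: a_def)
    then show False
      using *(4,5)[OF I(1)] L_borel spL by (subst (asm) AE_iff_measurable[OF _ refl]) auto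
  qed
  then obtain j where j: "emeasure L (a j) > 0" by blast
  define la where "la = emeasure L (a j)"
  define m where "m = emeasure M I'"
  have m: "0 < m" "m < \<infinity>" using *(6,7)[OF I(2), of 0] by (auto simp: m_def)
  define c where "c = ennreal (K * measure L I)"
  \<comment> \<open>The factor \<open>c / la\<close> comes from passing to \<open>a j\<close>, and
    the term with \<open>C\<close> from the shift by \<open>j\<close>.\<close>
  define D where "D = c * (1 + of_nat j * C / m) / la"
  have la: "la \<noteq> 0" "la \<noteq> top" using j by (auto simp: la_def)
  have "D < \<infinity>"
    using la m C by (auto simp: D_def c_def less_top[symmetric] ennreal_divide_eq_top_iff ennreal_mult_eq_top_iff)
  moreover have "orbit_sum M n I \<le> D * orbit_sum M n I'" for n
  proof (cases "n = 0")
    case True then show ?thesis by (simp add: orbit_sum_def)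
  next
    case False
    let ?S = "orbit_sum M n I'"
    \<comment> \<open>For positive \<open>n\<close> the zeroth term bounds \<open>?S\<close> from
      below; this turns the additive error \<open>of_nat j * C\<close> into a multiple of
      \<open>?S\<close>.\<close>
    have "m = (\<Sum>k\<in>{0}. emeasure M ((f ^^ k) -` I'))" by (simp add: m_def)
    also have "\<dots> \<le> ?S" unfolding orbit_sum_def using False by (intro sum_mono2) auto
    finally have mS: "m \<le> ?S" .
    have "of_nat j * C = of_nat j * C / m * m"
      using m by (simp add: ennreal_divide_times ennreal_divide_self)
    also have "\<dots> \<le> of_nat j * C / m * ?S" using mS by (intro mult_left_mono) auto
    finally have jC: "of_nat j * C \<le> of_nat j * C / m * ?S" .
    have "la * orbit_sum M n I \<le> c * orbit_sum M n (a j)"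
      unfolding orbit_sum_def sum_distrib_left la_def c_def
      using a by (intro sum_mono m2_bounds(2)[OF L *(5)[OF I(1)] K(1) *(1) vimage_iterate_borel[OF *(4)[OF I(1)]] K(2)])
    also have "\<dots> \<le> c * orbit_sum M n ((f ^^ j) -` I')"
      using *(1) vimage_iterate_borel[OF *(4)[OF I(2)]]
      by (intro mult_left_mono orbit_sum_mono) (auto simp: a_def)
    also have "\<dots> \<le> c * (?S + (\<Sum>k\<in>{n..<n+j}. C))"
      using C(2) by (intro mult_left_mono order_trans[OF orbit_sum_vimage_iterate_le] add_left_mono sum_mono) auto
    also have "\<dots> \<le> c * (?S + of_nat j * C / m * ?S)"
      using jC by (intro mult_left_mono add_left_mono) auto
    also have "\<dots> = c * (1 + of_nat j * C / m) * ?S" by (simp add: algebra_simps)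
    finally have "orbit_sum M n I * la / la \<le> c * (1 + of_nat j * C / m) * ?S / la"
      by (intro divide_right_mono_ennreal) (simp add: mult.commute)
    also have "\<dots> = D * ?S" by (simp add: D_def ennreal_divide_times ennreal_times_divide mult.commute)
    finally show ?thesis by (simp add: mult_divide_eq_ennreal[OF la])
  qed
  ultimately show ?thesis by blast
qed

text \<open>The properties are proved for the quotients and passed to the limit. Only the last has
  an extra boundary term, which vanishes because the normalising sums over \<open>I0\<close>
  diverge.\<close>

lemma orbit_average_limit:
  assumes L: "prob_space L" and G: "measure_partition L \<G>" "M \<in> MM_s L \<G> f" and I0: "I0 \<in> \<G>"
  obtains l :: "'a set \<Rightarrow> ennreal" where
    "l {} = 0" "l I0 = 1"
    "\<And>A B. A \<in> sets borel \<Longrightarrow> B \<in> sets borel \<Longrightarrow> A \<inter> B = {} \<Longrightarrow> l (A \<union> B) = l A + l B"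
    "\<And>I. I \<in> \<G> \<Longrightarrow> \<exists>c<\<infinity>. \<forall>A\<in>sets borel. A \<subseteq> I \<longrightarrow> l A \<le> c * emeasure L A"
    "\<And>I A. I \<in> \<G> \<Longrightarrow> A \<in> sets borel \<Longrightarrow> A \<subseteq> I \<Longrightarrow> l (f -` A) \<le> l A"
proof -
  note * = MM_sD[OF G]
  let ?S = "orbit_sum M"
  define s where "s n = ?S n I0" for n
  define q where "q n A = ?S n A / s n" for n A
  obtain U l where U: "U \<noteq> bot" "U \<le> sequentially" and l: "\<And>A. ((\<lambda>n. q n A) \<longlongrightarrow> l A) U"
    using exists_pointwise_limit_along_finer_filter[OF sequentially_bot, of q] by metis
  have s0: "s n \<noteq> 0" if "n \<ge> 1" for n
  proof -
    have "0 < (\<Sum>k\<in>{0}. emeasure M ((f ^^ k) -` I0))" using *(6)[OF I0, of 0] by simp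
    also have "\<dots> \<le> s n" unfolding s_def orbit_sum_def using that by (intro sum_mono2) auto
    finally show ?thesis by simp
  qed
  have s_fin: "s n \<noteq> top" for n
    unfolding s_def orbit_sum_def using *(7)[OF I0] by (simp add: less_top[symmetric])
  have "emeasure M UNIV \<noteq> 0"
    using *(6)[OF I0, of 0] *(1) emeasure_mono[of I0 UNIV M] by auto
  then have "(\<Sum>n. emeasure M ((f ^^ n) -` I0)) = \<infinity>"
    using orbit_sum_infinite *(1,2,4,5) I0 by blast
  moreover have "s \<longlonglongrightarrow> (\<Sum>n. emeasure M ((f ^^ n) -` I0))"
    unfolding s_def orbit_sum_def by (intro summable_LIMSEQ) simp
  ultimately have "s \<longlonglongrightarrow> top" by simp
  moreover have "continuous_on UNIV (inverse :: ennreal \<Rightarrow> ennreal)"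
    by (intro continuous_on_inverse_ennreal continuous_on_id)
  ultimately have "(\<lambda>n. inverse (s n)) \<longlonglongrightarrow> inverse top"
    by (intro continuous_on_tendsto_compose[where f=inverse and s=UNIV]) auto
  then have s_inv: "((\<lambda>n. inverse (s n)) \<longlongrightarrow> 0) U"
    using U(2) by (auto intro: filterlim_mono)
  \<comment> \<open>The index 0 must be avoided, since \<open>s 0\<close> is an empty sum and cannot
    serve as a denominator.\<close>
  have ev: "eventually P U" if "\<And>n. n \<ge> 1 \<Longrightarrow> P n" for P
    using U(2) that by (meson eventually_sequentiallyI filter_leD)
  show ?thesis
  proof (rule that[of l])
    have "((\<lambda>n. q n {}) \<longlongrightarrow> 0) U" by (simp add: q_def orbit_sum_def)
    then show "l {} = 0" using tendsto_unique[OF U(1) l] by blast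
    have "((\<lambda>n. q n I0) \<longlongrightarrow> 1) U"
      by (rule tendsto_eventually, rule ev)
        (use s0 s_fin in \<open>simp add: q_def s_def[symmetric] less_top[symmetric]\<close>)
    then show "l I0 = 1" using tendsto_unique[OF U(1) l] by blast
  next
    fix A B :: "'a set" assume AB: "A \<in> sets borel" "B \<in> sets borel" "A \<inter> B = {}"
    have "q n (A \<union> B) = q n A + q n B" for n
      by (simp add: q_def orbit_sum_Un[OF *(1) AB] add_divide_distrib_ennreal)
    then have "((\<lambda>n. q n (A \<union> B)) \<longlongrightarrow> l A + l B) U"
      using tendsto_add[OF l l] by simp
    then show "l (A \<union> B) = l A + l B" using tendsto_unique[OF U(1) l] by blast
  next
    fix I assume I: "I \<in> \<G>"
    obtain c where c: "c < \<infinity>" "\<And>A n. A \<in> sets borel \<Longrightarrow> A \<subseteq> I \<Longrightarrow> ?S n A \<le> c * emeasure L A * ?S n I"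
      using orbit_sum_dominated[OF L G I] by blast
    obtain D where D: "D < \<infinity>" "\<And>n. ?S n I \<le> D * s n"
      using orbit_sum_comparable[OF L G I I0] unfolding s_def by blast
    have "l A \<le> c * D * emeasure L A" if A: "A \<in> sets borel" "A \<subseteq> I" for A
    proof (rule tendsto_upperbound[OF l _ U(1)], rule ev)
      fix n :: nat assume n: "n \<ge> 1"
      have "?S n A \<le> c * emeasure L A * (D * s n)"
        using c(2)[OF A, of n] D(2)[of n] by (meson mult_left_mono order_trans zero_le)
      then have "q n A \<le> c * D * emeasure L A * s n / s n"
        unfolding q_def by (intro divide_right_mono_ennreal) (simp add: ac_simps)
      then show "q n A \<le> c * D * emeasure L A"
        by (simp add: mult_divide_eq_ennreal[OF s0[OF n] s_fin])
    qed
    moreover have "c * D < \<infinity>" using c(1) D(1) by (simp add: ennreal_mult_less_top)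
    ultimately show "\<exists>c<\<infinity>. \<forall>A\<in>sets borel. A \<subseteq> I \<longrightarrow> l A \<le> c * emeasure L A" by blast
  next
    fix I A assume I: "I \<in> \<G>" and A: "A \<in> sets borel" "A \<subseteq> I"
    obtain C where C: "C < \<infinity>" "\<And>n. emeasure M ((f ^^ n) -` I) \<le> C" using *(8)[OF I] by blast
    have "q n (f -` A) \<le> q n A + C * inverse (s n)" for n
    proof -
      \<comment> \<open>One preimage adds only the mass at time \<open>n\<close>, which
        \<open>m3\<close> bounds through \<open>I\<close> uniformly in \<open>n\<close>.\<close>
      have "emeasure M ((f ^^ n) -` A) \<le> emeasure M ((f ^^ n) -` I)"
        using A(2) vimage_iterate_borel[OF *(4)[OF I]] *(1) by (intro emeasure_mono) auto
      then have "?S n (f -` A) \<le> ?S n A + C"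
        using orbit_sum_vimage_iterate_le[of M n 1 A] C(2)[of n]
        by (simp add: eval_nat_numeral) (meson add_left_mono order_trans)
      then have "?S n (f -` A) / s n \<le> (?S n A + C) / s n" by (rule divide_right_mono_ennreal)
      then show ?thesis by (simp add: q_def add_divide_distrib_ennreal divide_ennreal_def distrib_right)
    qed
    moreover have "((\<lambda>n. q n A + C * inverse (s n)) \<longlongrightarrow> l A + C * 0) U"
      using C(1) by (intro tendsto_add l ennreal_tendsto_cmult s_inv) simp
    ultimately show "l (f -` A) \<le> l A"
      using tendsto_le[OF U(1) _ l] by (simp add: always_eventually)
  qed
qed

text \<open>On the whole space \<open>l\<close> is only finitely additive, and mass may escape
  across infinitely many pieces. Summing \<open>l\<close> over the pieces gives a measure that is at
  most \<open>l\<close> everywhere and agrees with it inside a piece.\<close>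

lemma subinvariant_measure_of_partition:
  assumes L: "prob_space L" and G: "measure_partition L \<G>" and I0: "I0 \<in> \<G>"
    and l: "l {} = 0" "l I0 = 1"
    "\<And>A B. A \<in> sets borel \<Longrightarrow> B \<in> sets borel \<Longrightarrow> A \<inter> B = {} \<Longrightarrow> l (A \<union> B) = l A + l B"
    "\<And>I. I \<in> \<G> \<Longrightarrow> \<exists>c<\<infinity>. \<forall>A\<in>sets borel. A \<subseteq> I \<longrightarrow> l A \<le> c * emeasure L A"
    "\<And>I A. I \<in> \<G> \<Longrightarrow> A \<in> sets borel \<Longrightarrow> A \<subseteq> I \<Longrightarrow> l (f -` A) \<le> (l A :: ennreal)"
  obtains N where "N \<in> sigma_finite_borel" "absolutely_continuous L N"
    "\<And>A. A \<in> sets borel \<Longrightarrow> emeasure N (f -` A) \<le> emeasure N A"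
    "0 < emeasure N I0" "emeasure N I0 < \<infinity>"
proof -
  interpret prob_space L by fact
  have Gb: "I \<in> sets borel" if "I \<in> \<G>" for I using G that by (auto simp: measure_partition_def)
  obtain J :: "nat \<Rightarrow> 'a set" where J: "disjoint_family J" "\<And>i. J i = {} \<or> J i \<in> \<G>"
    "\<Union>\<G> = (\<Union>i. J i)" "\<And>I. I \<in> \<G> \<Longrightarrow> \<exists>i. I = J i"
    using measure_partition_enumeration[OF G] by metis
  have Jb[measurable]: "J i \<in> sets borel" for i using J(2)[of i] Gb by auto
  have lmono: "l A \<le> l B" if "A \<subseteq> B" "A \<in> sets borel" "B \<in> sets borel" for A B
  proof -
    have "l B = l A + l (B - A)" using l(3)[of A "B - A"] that by (auto simp: Un_absorb1)
    then show ?thesis by simp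
  qed
  have dom: "\<exists>c<\<infinity>. \<forall>A\<in>sets borel. A \<subseteq> J i \<longrightarrow> l A \<le> c * emeasure L A" for i
  proof (cases "J i = {}")
    case True then show ?thesis using l(1) by (intro exI[of _ 0]) auto
  next
    case False then show ?thesis using J(2)[of i] l(4) by auto
  qed
  have lsub: "l (f -` A) \<le> l A" if "A \<in> sets borel" "A \<subseteq> J i" for A i
    using J(2)[of i] l(1,5) that by auto
  define \<nu> where "\<nu> A = (\<Sum>i. l (A \<inter> J i))" for A
  have ca: "countably_additive (sets borel) (\<lambda>A. l (A \<inter> J i))" for i
  proof -
    obtain c where c: "c < \<infinity>" "\<And>A. A \<in> sets borel \<Longrightarrow> A \<subseteq> J i \<Longrightarrow> l A \<le> c * emeasure L A"
      using dom by blast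
    have "countably_additive (sets L) (\<lambda>A. l (A \<inter> J i))"
    proof (rule dominated_additive_imp_countably_additive[OF finite_measure_axioms _ _ _ c(1)])
      fix A B assume "A \<in> sets L" "B \<in> sets L" "A \<inter> B = {}"
      then show "l ((A \<union> B) \<inter> J i) = l (A \<inter> J i) + l (B \<inter> J i)"
        unfolding Int_Un_distrib2 using L_borel by (intro l(3)) auto
    next
      fix A assume A: "A \<in> sets L"
      have "l (A \<inter> J i) \<le> c * emeasure L (A \<inter> J i)" using A L_borel by (intro c(2)) auto
      also have "\<dots> \<le> c * emeasure L A" using A by (intro mult_left_mono emeasure_mono) auto
      finally show "l (A \<inter> J i) \<le> c * emeasure L A" .
    qed (simp add: l(1))
    then show ?thesis by (simp add: L_borel)
  qed
  have ca\<nu>: "countably_additive (sets borel) \<nu>"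
    unfolding countably_additive_def
  proof (intro allI impI)
    fix A :: "nat \<Rightarrow> 'a set"
    assume A: "range A \<subseteq> sets borel" "disjoint_family A" "(\<Union>i. A i) \<in> sets borel"
    have "(\<Sum>k. \<nu> (A k)) = (\<Sum>i. \<Sum>k. l (A k \<inter> J i))"
      unfolding \<nu>_def by (rule suminf_swap_ennreal)
    also have "\<dots> = (\<Sum>i. l ((\<Union>k. A k) \<inter> J i))"
      using ca A unfolding countably_additive_def by (intro suminf_cong) blast
    finally show "(\<Sum>k. \<nu> (A k)) = \<nu> (\<Union>k. A k)" by (simp add: \<nu>_def)
  qed
  define N where "N = measure_of UNIV (sets borel) \<nu>"
  have sN: "sets N = sets borel"
    unfolding N_def using sets.sigma_sets_eq[of borel] by simp
  have spN: "space N = UNIV" using sets_eq_imp_space_eq[OF sN] by simp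
  have N: "emeasure N A = \<nu> A" if "A \<in> sets borel" for A
    unfolding N_def using sets.sigma_algebra_axioms[of borel] that ca\<nu>
    by (intro emeasure_measure_of_sigma) (auto simp: positive_def \<nu>_def l(1))
  have \<nu>_le: "\<nu> A \<le> l A" if A: "A \<in> sets borel" for A
    unfolding \<nu>_def
  proof (rule suminf_le_const[OF summableI])
    fix n
    \<comment> \<open>Finite additivity turns a partial sum into the value of \<open>l\<close> on a
      subset of \<open>A\<close>.\<close>
    have "(\<Sum>i<n. l (A \<inter> J i)) = l (A \<inter> (\<Union>i<n. J i))"
    proof (induction n)
      case (Suc n)
      have "A \<inter> (\<Union>i<Suc n. J i) = (A \<inter> (\<Union>i<n. J i)) \<union> (A \<inter> J n)" by (auto simp: less_Suc_eq)
      moreover have "l \<dots> = l (A \<inter> (\<Union>i<n. J i)) + l (A \<inter> J n)"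
        using A J(1) by (intro l(3)) (auto simp: disjoint_family_on_def dest: less_not_refl3)
      ultimately show ?case using Suc by simp
    qed (simp add: l(1))
    also have "\<dots> \<le> l A" using A by (intro lmono) auto
    finally show "(\<Sum>i<n. l (A \<inter> J i)) \<le> l A" .
  qed
  have \<nu>_ge: "l A \<le> \<nu> A" if "A \<subseteq> J k" for A k
    using sum_le_suminf[of "\<lambda>i. l (A \<inter> J i)" "{k}"] that by (simp add: \<nu>_def Int_absorb2)
  have ac: "absolutely_continuous L N"
    unfolding absolutely_continuous_def
  proof
    fix A assume A: "A \<in> null_sets L"
    then have Ab: "A \<in> sets borel" using L_borel by (auto simp: null_sets_def)
    have "l (A \<inter> J i) = 0" for i
    proof -
      obtain c where "\<And>A. A \<in> sets borel \<Longrightarrow> A \<subseteq> J i \<Longrightarrow> l A \<le> c * emeasure L A"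
        using dom by blast
      then have "l (A \<inter> J i) \<le> c * emeasure L (A \<inter> J i)" using Ab by simp
      moreover have "emeasure L (A \<inter> J i) \<le> emeasure L A" using A by (intro emeasure_mono) auto
      ultimately show ?thesis using A by (auto simp: null_sets_def)
    qed
    then show "A \<in> null_sets N" using Ab sN N by (simp add: null_sets_def \<nu>_def)
  qed
  have fin: "emeasure N (J i) < \<infinity>" for i
  proof -
    obtain c where c: "c < \<infinity>" "l (J i) \<le> c * emeasure L (J i)" using dom[of i] Jb by blast
    have "emeasure N (J i) \<le> c * emeasure L (J i)" using c(2) \<nu>_le[OF Jb] N[OF Jb] by (metis order_trans)
    also have "\<dots> < \<infinity>" using c(1) by (simp add: ennreal_mult_less_top emeasure_eq_measure)
    finally show ?thesis .
  qed
  \<comment> \<open>This null remainder completes the pieces of finite measure to a cover of the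
    whole space.\<close>
  define Z where "Z = UNIV - (\<Union>i. J i)"
  have Zb: "Z \<in> sets borel" by (auto simp: Z_def)
  have LZ: "emeasure L Z = 0" using G J(3) by (simp add: measure_partition_def Z_def)
  have NZ: "emeasure N A = 0" if "A \<in> sets borel" "emeasure L A = 0" for A
    using absolutely_continuousD[OF ac] that L_borel by simp
  have "sigma_finite_measure N"
  proof
    show "\<exists>A. countable A \<and> A \<subseteq> sets N \<and> \<Union>A = space N \<and> (\<forall>a\<in>A. emeasure N a \<noteq> \<infinity>)"
      using fin NZ[OF Zb LZ] Zb
      by (intro exI[of _ "insert Z (range J)"]) (auto simp: sN spN Z_def less_top)
  qed
  moreover have "emeasure N (f -` A) \<le> emeasure N A" if A: "A \<in> sets borel" for A
  proof -
    have Ak: "A \<inter> J k \<in> sets borel" for k using A by simp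
    \<comment> \<open>The preimage of a subset of one piece may meet infinitely many pieces. There
      \<open>N\<close> is at most \<open>l\<close>, then \<open>l\<close> decreases under the
      preimage, and inside the piece \<open>N\<close> and \<open>l\<close> agree. The part over
      \<open>Z\<close> is null by nonsingularity.\<close>
    have "f -` A = (\<Union>k. f -` (A \<inter> J k)) \<union> f -` (A \<inter> Z)" by (auto simp: Z_def)
    also have "emeasure N \<dots> \<le> emeasure N (\<Union>k. f -` (A \<inter> J k)) + emeasure N (f -` (A \<inter> Z))"
      using vimage_borel[OF Ak] vimage_borel[of "A \<inter> Z"] A Zb sN
      by (intro emeasure_subadditive) (auto simp del: vimage_Int)
    also have "emeasure N (f -` (A \<inter> Z)) = 0"
    proof (rule NZ)
      have "emeasure L (A \<inter> Z) \<le> emeasure L Z" using Zb L_borel by (intro emeasure_mono) auto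
      then show "emeasure L (f -` (A \<inter> Z)) = 0" using LZ A Zb by (intro null_vimage) auto
    qed (use A Zb in \<open>intro vimage_borel, auto\<close>)
    also have "emeasure N (\<Union>k. f -` (A \<inter> J k)) \<le> (\<Sum>k. emeasure N (f -` (A \<inter> J k)))"
      using vimage_borel[OF Ak] sN by (intro emeasure_subadditive_countably) (auto simp del: vimage_Int)
    also have "\<dots> \<le> (\<Sum>k. emeasure N (A \<inter> J k))"
    proof (intro suminf_le summableI)
      fix k
      have "emeasure N (f -` (A \<inter> J k)) \<le> l (f -` (A \<inter> J k))"
        using \<nu>_le N vimage_borel[OF Ak] by (simp del: vimage_Int)
      also have "\<dots> \<le> l (A \<inter> J k)" using Ak by (intro lsub) auto
      also have "\<dots> \<le> emeasure N (A \<inter> J k)" using \<nu>_ge[of "A \<inter> J k" k] N[OF Ak] by simp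
      finally show "emeasure N (f -` (A \<inter> J k)) \<le> emeasure N (A \<inter> J k)" .
    qed
    also have "\<dots> = emeasure N (\<Union>k. A \<inter> J k)"
      using J(1) Ak sN by (intro suminf_emeasure) (auto simp: disjoint_family_on_def)
    also have "\<dots> \<le> emeasure N A" using A sN by (intro emeasure_mono) auto
    finally show ?thesis by simp
  qed
  moreover obtain k where k: "I0 = J k" using J(4)[OF I0] by blast
  moreover have "0 < emeasure N I0"
    using \<nu>_ge[of I0 k] k l(2) N[OF Jb, of k] by (auto intro: less_le_trans[of 0 1])
  ultimately show ?thesis using that[of N] sN ac fin[of k] by (auto simp: sigma_finite_borel_def)
qed

text \<open>One piece \<open>I0\<close> plays two roles: it normalises the averages, so that the
  limit is nonzero, and it is the set of finite measure on which the invariance defect is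
  tested.\<close>

lemma partition_imp_invariant:
  assumes L: "prob_space L" and G: "measure_partition L \<G>" "M \<in> MM_s L \<G> f"
  shows "\<exists>N\<in>sigma_finite_borel. absolutely_continuous L N \<and> distr N borel f = N \<and> emeasure N UNIV \<noteq> 0"
proof -
  interpret prob_space L by fact
  have "space L = UNIV" using sets_eq_imp_space_eq[OF L_borel] by simp
  \<comment> \<open>An empty union cannot have full measure in a probability space.\<close>
  then have "\<G> \<noteq> {}" using G(1) emeasure_space_1 by (auto simp: measure_partition_def)
  then obtain I0 where I0: "I0 \<in> \<G>" by blast
  show ?thesis
  proof (rule orbit_average_limit[OF L G I0])
    fix l :: "'a set \<Rightarrow> ennreal"
    assume l: "l {} = 0" "l I0 = 1"
      "\<And>A B. A \<in> sets borel \<Longrightarrow> B \<in> sets borel \<Longrightarrow> A \<inter> B = {} \<Longrightarrow> l (A \<union> B) = l A + l B"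
      "\<And>I. I \<in> \<G> \<Longrightarrow> \<exists>c<\<infinity>. \<forall>A\<in>sets borel. A \<subseteq> I \<longrightarrow> l A \<le> c * emeasure L A"
      "\<And>I A. I \<in> \<G> \<Longrightarrow> A \<in> sets borel \<Longrightarrow> A \<subseteq> I \<Longrightarrow> l (f -` A) \<le> l A"
    show ?thesis
    proof (rule subinvariant_measure_of_partition[OF L G(1) I0 l])
      fix N
      assume N: "N \<in> sigma_finite_borel" "absolutely_continuous L N"
        "\<And>A. A \<in> sets borel \<Longrightarrow> emeasure N (f -` A) \<le> emeasure N A"
        "0 < emeasure N I0" "emeasure N I0 < \<infinity>"
      have "distr N borel f = N"
        using subinvariant_imp_invariant[OF N(1-3) MM_sD(4,5)[OF G I0] N(5)] .
      moreover have "emeasure N I0 \<le> emeasure N UNIV"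
        using N(1) by (intro emeasure_mono) (auto simp: sigma_finite_borel_def)
      ultimately show ?thesis using N by (intro bexI[of _ N]) auto
    qed
  qed
qed

end

theorem corollary2p8:
  fixes L :: "'a::topological_space measure" and f :: "'a \<Rightarrow> 'a"
  assumes X_sigma_compact: "sigma_compact (UNIV :: 'a set)"
    and L_borel: "sets L = sets borel"
    and L_prob: "prob_space L"
    and L_regular: "inner_regular_compact L"
    and f_borel: "f \<in> borel_measurable borel"
    and f_nonsingular: "absolutely_continuous L (distr L borel f)"
    and f_ergodic_conservative: "ergodic_conservative L f"
  shows "(\<exists>M\<in>sigma_finite_borel. absolutely_continuous L M \<and>
            distr M borel f = M \<and> emeasure M UNIV \<noteq> 0)
     \<longleftrightarrow> (\<exists>\<G>. measure_partition L \<G> \<and> MM_s L \<G> f \<noteq> {})"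
proof -
  interpret conservative_system L f
    using L_borel f_borel f_nonsingular f_ergodic_conservative by unfold_locales
  show ?thesis
    using invariant_imp_partition[OF L_prob L_regular] partition_imp_invariant[OF L_prob] by blast
qed

end
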